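(* Let $\{T_\theta\}_{\theta\in\Theta}$ be a family of deterministic dynamics $T_\theta:\mathcal{S}\times\mathcal{A}\to\mathcal{S}$ with parameter set $\Theta\subset\mathbb{R}^p$ compact, let $r:\mathcal{S}\times\mathcal{A}\to[0,1]$ be a reward function, $\gamma\in[0,1)$ a discount factor, $s_0\in\mathcal{S}$ an initial state and $H>0$ a finite horizon. Then the surrogate objective $\hat{v^r}$ is a lower bound of the robust objective $v^r$: for every policy $\pi:\mathcal{S}\to\mathcal{A}$, $$\hat{v^r}(\pi)\le v^r(\pi).$$
   Context: The state space $\mathcal{S}$ is a subset of some $\mathbb{R}^q$, ordered componentwise, and contains all the intervals below. For a policy $\pi:\mathcal{S}\to\mathcal{A}$ and $\theta\in\Theta$, the trajectory is $s_{t+1}=T_\theta(s_t,a_t)$ with $a_t=\pi(s_t)$, started at $s_0$. Its return is $R^{T_\theta}_\pi=\sum_{t=0}^\infty\gamma^t r(s_t,a_t)$, and its value is $v^{T_\theta}_\pi=\mathbb{E}(R^{T_\theta}_\pi)$, which equals $R^{T_\theta}_\pi$ since everything is deterministic. The robust objective is $v^r(\pi)=\min_{\theta\in\Theta}v^{T_\theta}_\pi$. The reachability set at time $t$ is $$S(t,s_0,\pi)=\{s_t:\ \exists\theta\in\Theta\text{ such that } s_{k+1}=T_\theta(s_k,a_k),\ a_k=\pi(s_k),\ k=0,\dots,t-1\}.$$ Its interval hull is $\square S(t,s_0,\pi)=[\underline{s},\overline{s}]=\{x\in\mathbb{R}^q:\underline{s}\le x\le\overline{s}\}$, where $\underline{s}=\min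 S(t,s_0,\pi)$ and $\overline{s}=\max S(t,s_0,\pi)$ are taken componentwise; it is the smallest interval containing $S(t,s_0,\pi)$. The surrogate objective is $$\hat{v^r}(\pi)=\sum_{t=0}^H\gamma^t\min_{s\in\square S(t,s_0,\pi)}r(s,\pi(s)).$$ All minima and maxima are understood as infima and suprema (possibly infinite for the components of $\underline{s},\overline{s}$) when they are not attained. *)

theory Defs
  imports "HOL-Probability.Probability"
begin

primrec trajectory :: "('s \<times> 'a \<Rightarrow> 's) \<Rightarrow> ('s \<Rightarrow> 'a) \<Rightarrow> 's \<Rightarrow> nat \<Rightarrow> 's" where
  "trajectory T \<pi> s0 0 = s0"
| "trajectory T \<pi> s0 (Suc t) = T (trajectory T \<pi> s0 t, \<pi> (trajectory T \<pi> s0 t))"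

definition discounted_return ::
    "('s \<times> 'a \<Rightarrow> real) \<Rightarrow> real \<Rightarrow> ('s \<Rightarrow> 'a) \<Rightarrow> (nat \<Rightarrow> 's) \<Rightarrow> real" where
  "discounted_return r \<gamma> \<pi> s = (\<Sum>t. \<gamma> ^ t * r (s t, \<pi> (s t)))"

text \<open>The dynamics, the policy and the initial state are deterministic, so the law of the
  trajectory is a point mass; the value is the expected return under that law.\<close>

definition policy_value ::
    "('s \<times> 'a \<Rightarrow> 's) \<Rightarrow> ('s \<times> 'a \<Rightarrow> real) \<Rightarrow> real \<Rightarrow> 's \<Rightarrow> ('s \<Rightarrow> 'a) \<Rightarrow> real" where
  "policy_value T r \<gamma> s0 \<pi> =
     measure_pmf.expectation (return_pmf (trajectory T \<pi> s0)) (discounted_return r \<gamma> \<pi>)"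

text \<open>Minima and maxima are infima and suprema in the extended reals. In particular the infimum
  over an empty set is \<open>\<infinity>\<close>, so no nonemptiness of the parameter set is needed.\<close>

definition robust_objective ::
    "'p set \<Rightarrow> ('p \<Rightarrow> 's \<times> 'a \<Rightarrow> 's) \<Rightarrow> ('s \<times> 'a \<Rightarrow> real) \<Rightarrow> real \<Rightarrow> 's \<Rightarrow> ('s \<Rightarrow> 'a) \<Rightarrow> ereal"
  where
  "robust_objective \<Theta> T r \<gamma> s0 \<pi> = (INF \<theta>\<in>\<Theta>. ereal (policy_value (T \<theta>) r \<gamma> s0 \<pi>))"

definition reach_set ::
    "'p set \<Rightarrow> ('p \<Rightarrow> 's \<times> 'a \<Rightarrow> 's) \<Rightarrow> nat \<Rightarrow> 's \<Rightarrow> ('s \<Rightarrow> 'a) \<Rightarrow> 's set" where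
  "reach_set \<Theta> T t s0 \<pi> = {trajectory (T \<theta>) \<pi> s0 t |\<theta>. \<theta> \<in> \<Theta>}"

text \<open>The bounds are taken componentwise and may be infinite.\<close>

definition lower_bound :: "(real ^ 'q) set \<Rightarrow> 'q \<Rightarrow> ereal" where
  "lower_bound X i = (INF x\<in>X. ereal (x $ i))"

definition upper_bound :: "(real ^ 'q) set \<Rightarrow> 'q \<Rightarrow> ereal" where
  "upper_bound X i = (SUP x\<in>X. ereal (x $ i))"

definition interval_hull :: "(real ^ 'q) set \<Rightarrow> (real ^ 'q) set" where
  "interval_hull X = {x. \<forall>i. lower_bound X i \<le> ereal (x $ i) \<and> ereal (x $ i) \<le> upper_bound X i}"

definition surrogate_objective ::
    "'p set \<Rightarrow> ('p \<Rightarrow> (real ^ 'q) \<times> 'a \<Rightarrow> real ^ 'q) \<Rightarrow> ((real ^ 'q) \<times> 'a \<Rightarrow> real) \<Rightarrow> real \<Rightarrow> nat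
      \<Rightarrow> real ^ 'q \<Rightarrow> (real ^ 'q \<Rightarrow> 'a) \<Rightarrow> ereal" where
  "surrogate_objective \<Theta> T r \<gamma> H s0 \<pi> =
     (\<Sum>t\<le>H. ereal (\<gamma> ^ t) * (INF s \<in> interval_hull (reach_set \<Theta> T t s0 \<pi>). ereal (r (s, \<pi> s))))"

end

theory Submission
  imports Defs
begin

text \<open>Fix a parameter \<theta>. At each time t the state reached under \<theta> belongs to the
  reachability set, hence to its hull (\<open>subset_interval_hull\<close>), so the worst reward
  over the hull is at most the reward actually collected. Summing with weights \<gamma>^t up to H
  bounds the surrogate by the truncated return, and truncation only drops nonnegative terms
  (\<open>discounted_return_ge_partial_sum\<close>). The bound is uniform in \<theta>, so it passes
  to the infimum.\<close>

lemma subset_interval_hull: "X \<subseteq> interval_hull X"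
  by (auto simp: interval_hull_def lower_bound_def upper_bound_def intro: INF_lower SUP_upper)

text \<open>Rewards are controlled only on \<open>S \<times> A\<close>; this invariance makes that
  control available along a whole trajectory.\<close>

lemma trajectory_in:
  assumes "T \<in> S \<times> A \<rightarrow> S" and "\<pi> \<in> S \<rightarrow> A" and "s0 \<in> S"
  shows "trajectory T \<pi> s0 t \<in> S"
  using assms by (induction t) auto

lemma policy_value_eq: "policy_value T r \<gamma> s0 \<pi> = discounted_return r \<gamma> \<pi> (trajectory T \<pi> s0)"
  by (simp add: policy_value_def)

text \<open>Nonnegative rewards make the tail nonnegative. Rewards at most 1 give domination by the
  geometric series, so the infinite sum is a genuine limit.\<close>

lemma discounted_return_ge_partial_sum:
  assumes "0 \<le> \<gamma>" and "\<gamma> < 1" and r: "\<And>t. r (s t, \<pi> (s t)) \<in> {0..1}"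
  shows "(\<Sum>t\<le>H. \<gamma> ^ t * r (s t, \<pi> (s t))) \<le> discounted_return r \<gamma> \<pi> s"
proof -
  have "summable (\<lambda>t. \<gamma> ^ t * r (s t, \<pi> (s t)))"
  proof (rule summable_comparison_test)
    show "\<exists>N. \<forall>t\<ge>N. norm (\<gamma> ^ t * r (s t, \<pi> (s t))) \<le> \<gamma> ^ t"
      using assms by (auto simp: abs_mult intro!: mult_left_le)
    show "summable (\<lambda>t. \<gamma> ^ t)"
      using assms by (intro summable_geometric) auto
  qed
  then show ?thesis
    unfolding discounted_return_def using assms by (intro sum_le_suminf) auto
qed

theorem mainTheorem2:
  fixes S :: "(real ^ 'q) set" and A :: "'a set" and \<Theta> :: "(real ^ 'p) set"
    and T :: "real ^ 'p \<Rightarrow> (real ^ 'q) \<times> 'a \<Rightarrow> real ^ 'q"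
    and r :: "(real ^ 'q) \<times> 'a \<Rightarrow> real"
    and \<gamma> :: real and s0 :: "real ^ 'q" and H :: nat and \<pi> :: "real ^ 'q \<Rightarrow> 'a"
  assumes "compact \<Theta>"
    and "\<And>\<theta>. \<theta> \<in> \<Theta> \<Longrightarrow> T \<theta> \<in> S \<times> A \<rightarrow> S"
    and "r \<in> S \<times> A \<rightarrow> {0..1}"
    and "0 \<le> \<gamma>" and "\<gamma> < 1"
    and "s0 \<in> S" and "H > 0"
    and "\<pi> \<in> S \<rightarrow> A"
    and "\<And>t. t \<le> H \<Longrightarrow> interval_hull (reach_set \<Theta> T t s0 \<pi>) \<subseteq> S"
  shows "surrogate_objective \<Theta> T r \<gamma> H s0 \<pi> \<le> robust_objective \<Theta> T r \<gamma> s0 \<pi>"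
  unfolding robust_objective_def
proof (rule INF_greatest)
  \<comment> \<open>An empty \<open>\<Theta>\<close> is covered too: the infimum is then
    infinite.\<close>
  fix \<theta> assume \<theta>: "\<theta> \<in> \<Theta>"
  let ?s = "trajectory (T \<theta>) \<pi> s0"
  have "?s t \<in> S" for t
    by (rule trajectory_in[OF assms(2)[OF \<theta>] assms(8,6)])
  then have r01: "r (?s t, \<pi> (?s t)) \<in> {0..1}" for t
    using assms(3,8) by (auto simp: Pi_iff)
  have "?s t \<in> interval_hull (reach_set \<Theta> T t s0 \<pi>)" for t
    by (rule subsetD[OF subset_interval_hull]) (use \<theta> in \<open>auto simp: reach_set_def\<close>)
  \<comment> \<open>Each infimum is bounded by its value at the point \<open>?s t\<close> of the
    hull; the weights are nonnegative, so the extended-real products keep the inequality.\<close>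
  then have "surrogate_objective \<Theta> T r \<gamma> H s0 \<pi>
      \<le> (\<Sum>t\<le>H. ereal (\<gamma> ^ t) * ereal (r (?s t, \<pi> (?s t))))"
    unfolding surrogate_objective_def
    using assms(4) by (intro sum_mono ereal_mult_left_mono INF_lower) auto
  also have "\<dots> = ereal (\<Sum>t\<le>H. \<gamma> ^ t * r (?s t, \<pi> (?s t)))"
    by simp
  also have "\<dots> \<le> ereal (policy_value (T \<theta>) r \<gamma> s0 \<pi>)"
    using discounted_return_ge_partial_sum[OF assms(4,5), of r ?s \<pi>] r01
    by (simp add: policy_value_eq)
  finally show "surrogate_objective \<Theta> T r \<gamma> H s0 \<pi> \<le> ereal (policy_value (T \<theta>) r \<gamma> s0 \<pi>)" .
qed

end
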